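(* Let $F:\mathbb{R}^n\times\mathbb{R}^m\to\mathbb{R}$ be of the form $F(x,z)=g(z)^\top x$, where $g:\mathbb{R}^m\to\mathbb{R}^n$ is $\mathcal C^1$. Assume that there exists $(x_*,z_* )\in\operatorname{Saddle}(F)$ such that (i) $F(x_*,z_* )\ge F(x_*,z)$ for all $z\in\mathbb{R}^m$; (ii) for any $z\in\mathbb{R}^m$, the condition $g(z)^\top x_*=0$ implies $g(z)=0$; (iii) any trajectory of the saddle-point dynamics $X_{\text{sp}}$ of $F$ is bounded. Then all trajectories of the saddle-point dynamics $X_{\text{sp}}$ converge asymptotically to the set of equilibrium points of $X_{\text{sp}}$.
   Context: Saddle-point dynamics: for a continuously differentiable $F:\mathbb{R}^n\times\mathbb{R}^m\to\mathbb{R}$ it is $\dot x=-\nabla_xF(x,z)$, $\dot z=\nabla_zF(x,z)$, with vector field denoted $X_{\text{sp}}$. Trajectories are solutions on $t\ge 0$; a trajectory converges asymptotically to a set if its distance to the set tends to $0$ as $t\to\infty$. Saddle points: $(x_*,z_* )$ is a (local min-max) saddle point of $F$ if there are open neighborhoods $\mathcal U_{x_*}\subset\mathbb{R}^n$ of $x_*$ and $\mathcal U_{z_*}\subset\mathbb{R}^m$ of $z_*$ with $F(x_*,z)\le F(x_*,z_* )\le F(x,z_* )$ for all $z\in\mathcal U_{z_*}$, $x\in\mathcal U_{x_*}$. $\operatorname{Saddle}(F)$ is the set of all such points. *)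

theory Defs
  imports "HOL-Analysis.Analysis"
begin

definition C1_map :: "('a::real_normed_vector \<Rightarrow> 'b::real_normed_vector) \<Rightarrow> bool" where
  "C1_map f \<longleftrightarrow>
     (\<exists>f' :: 'a \<Rightarrow> 'a \<Rightarrow>\<^sub>L 'b.
        (\<forall>x. (f has_derivative blinfun_apply (f' x)) (at x)) \<and> continuous_on UNIV f')"

(* Meaningful only where f is differentiable; see gradient_eqI. *)
definition gradient :: "('a::real_inner \<Rightarrow> real) \<Rightarrow> 'a \<Rightarrow> 'a" where
  "gradient f x = (THE D. GDERIV f x :> D)"

lemma gradient_eqI:
  assumes "GDERIV f x :> D"
  shows "gradient f x = D"
  unfolding gradient_def
proof (rule the_equality)
  fix D' assume "GDERIV f x :> D'"
  with assms have "(\<lambda>h. h \<bullet> D') = (\<lambda>h. h \<bullet> D)"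
    unfolding gderiv_def by (rule has_derivative_unique[symmetric])
  then have "\<forall>h. h \<bullet> D' = h \<bullet> D" by metis
  then show "D' = D" by (metis vector_eq_rdot inner_commute)
qed (rule assms)

definition saddle_point_field ::
    "('a::real_inner \<times> 'b::real_inner \<Rightarrow> real) \<Rightarrow> 'a \<times> 'b \<Rightarrow> 'a \<times> 'b" where
  "saddle_point_field F =
     (\<lambda>(x, z). (- gradient (\<lambda>x'. F (x', z)) x, gradient (\<lambda>z'. F (x, z')) z))"

definition Saddle ::
    "('a::topological_space \<times> 'b::topological_space \<Rightarrow> real) \<Rightarrow> ('a \<times> 'b) set" where
  "Saddle F = {(xs, zs). \<exists>U V. open U \<and> xs \<in> U \<and> open V \<and> zs \<in> V \<and>
     (\<forall>z\<in>V. \<forall>x\<in>U. F (xs, z) \<le> F (xs, zs) \<and> F (xs, zs) \<le> F (x, zs))}"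

(* Only the values on [0, \<infinity>) matter; at t = 0 the derivative is one-sided. *)
definition trajectory :: "('a::real_normed_vector \<Rightarrow> 'a) \<Rightarrow> (real \<Rightarrow> 'a) \<Rightarrow> bool" where
  "trajectory X \<gamma> \<longleftrightarrow>
     (\<forall>t\<ge>0. (\<gamma> has_vector_derivative X (\<gamma> t)) (at t within {0..}))"

definition equilibria :: "('a::zero \<Rightarrow> 'a) \<Rightarrow> 'a set" where
  "equilibria X = {p. X p = 0}"

(* The nonemptiness conjunct is needed because infdist _ {} = 0. *)
definition converges_to_set :: "(real \<Rightarrow> 'a::metric_space) \<Rightarrow> 'a set \<Rightarrow> bool" where
  "converges_to_set \<gamma> S \<longleftrightarrow>
     S \<noteq> {} \<and> ((\<lambda>t. infdist (\<gamma> t) S) \<longlongrightarrow> 0) at_top"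

end

theory Submission
  imports Defs
begin

text \<open>The local minimality of the linear map \<open>F(\<cdot>, zs)\<close> at \<open>xs\<close> forces \<open>g zs = 0\<close>, so (i) says
  that \<open>g z \<bullet> xs \<le> 0\<close> for every \<open>z\<close>; hence \<open>t \<mapsto> x t \<bullet> xs\<close> is nondecreasing. LaSalle's principle
  is awkward because the field is merely continuous, so that solutions need not be unique;
  Barbalat's lemma replaces it. Applied to \<open>x t \<bullet> xs\<close> it yields \<open>g (z t) \<bullet> xs \<longrightarrow> 0\<close>, hence
  \<open>g (z t) \<longrightarrow> 0\<close> by (ii) and compactness. Then \<open>F \<longrightarrow> 0\<close> along the trajectory, and Barbalat's
  lemma applied to \<open>F\<close>, whose derivative is \<open>\<bar>z'\<bar>\<^sup>2 - \<bar>g z\<bar>\<^sup>2\<close>, yields \<open>z' \<longrightarrow> 0\<close>. So the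
  field tends to \<open>0\<close> along the bounded trajectory, which therefore approaches its zero set.\<close>

lemma mvt_halfline:
  fixes f f' :: "real \<Rightarrow> real"
  assumes deriv: "\<And>t. t \<ge> 0 \<Longrightarrow> (f has_vector_derivative f' t) (at t within {0..})"
    and "0 \<le> s" "s \<le> t"
  shows "\<exists>c\<in>{s..t}. f t - f s = (t - s) * f' c"
proof -
  have "(f has_derivative (\<lambda>h. h *\<^sub>R f' c)) (at c within {s..t})" if "s \<le> c" "c \<le> t" for c
    using deriv[of c] that \<open>0 \<le> s\<close> unfolding has_vector_derivative_def
    by (auto intro: has_derivative_subset)
  from mvt_very_simple[OF \<open>s \<le> t\<close> this] show ?thesis by simp
qed

text \<open>By the mean value theorem, \<open>f'\<close> at some point of a short window after
  \<open>t\<close> equals a difference quotient of \<open>f\<close>, which is small because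
  \<open>f\<close> converges. Uniform continuity carries the smallness back to \<open>t\<close>,
  with a window length independent of \<open>t\<close>.\<close>

lemma barbalat:
  fixes f f' :: "real \<Rightarrow> real"
  assumes deriv: "\<And>t. t \<ge> 0 \<Longrightarrow> (f has_vector_derivative f' t) (at t within {0..})"
    and uc: "uniformly_continuous_on {0..} f'"
    and lim: "(f \<longlongrightarrow> L) at_top"
  shows "(f' \<longlongrightarrow> 0) at_top"
proof (rule tendstoI)
  fix e :: real assume e: "e > 0"
  obtain d where d: "d > 0"
    and dd: "\<And>s t. s \<ge> 0 \<Longrightarrow> t \<ge> 0 \<Longrightarrow> dist s t < d \<Longrightarrow> dist (f' s) (f' t) < e / 2"
    using uc e unfolding uniformly_continuous_on_def by (metis atLeast_iff half_gt_zero)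
  \<comment> \<open>Two such errors bound the increment over a window of length \<open>d / 2\<close>
    by \<open>e * d / 4\<close>, so the difference quotient stays below
    \<open>e / 2\<close>.\<close>
  have "eventually (\<lambda>t. dist (f t) L < e * d / 8) at_top"
    using lim e d by (intro tendstoD) auto
  then obtain N where N: "\<And>t. t \<ge> N \<Longrightarrow> dist (f t) L < e * d / 8"
    unfolding eventually_at_top_linorder by blast
  show "eventually (\<lambda>t. dist (f' t) 0 < e) at_top"
    unfolding eventually_at_top_linorder
  proof (intro exI[of _ "max N 0"] allI impI)
    fix t assume "t \<ge> max N 0"
    then have t: "t \<ge> N" "t \<ge> 0" by auto
    obtain c where c: "t \<le> c" "c \<le> t + d / 2" and eq: "f (t + d / 2) - f t = d / 2 * f' c"
      using mvt_halfline[OF deriv, of t "t + d / 2"] t d by auto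
    have "\<bar>f (t + d / 2) - f t\<bar> < e * d / 4"
      using N[of t] N[of "t + d / 2"] t d unfolding dist_real_def by linarith
    then have "d / 2 * \<bar>f' c\<bar> < d / 2 * (e / 2)"
      using d by (simp add: eq abs_mult)
    then have "\<bar>f' c\<bar> < e / 2"
      using d by (simp add: mult_less_cancel_left)
    moreover have "dist (f' t) (f' c) < e / 2"
      using dd[of t c] t c d by (simp add: dist_real_def)
    ultimately show "dist (f' t) 0 < e" unfolding dist_real_def by linarith
  qed
qed

text \<open>Monotonicity and the upper bound make \<open>f\<close> converge to its supremum, which
  supplies the limit that \<open>barbalat\<close> asks for.\<close>

lemma barbalat_nondecreasing:
  fixes f f' :: "real \<Rightarrow> real"
  assumes deriv: "\<And>t. t \<ge> 0 \<Longrightarrow> (f has_vector_derivative f' t) (at t within {0..})"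
    and uc: "uniformly_continuous_on {0..} f'"
    and nonneg: "\<And>t. t \<ge> 0 \<Longrightarrow> f' t \<ge> 0"
    and bdd: "bdd_above (f ` {0..})"
  shows "(f' \<longlongrightarrow> 0) at_top"
proof -
  have mono: "f s \<le> f t" if "0 \<le> s" "s \<le> t" for s t
  proof -
    obtain c where "c \<in> {s..t}" "f t - f s = (t - s) * f' c"
      using mvt_halfline[OF deriv \<open>0 \<le> s\<close> \<open>s \<le> t\<close>] by blast
    moreover have "(t - s) * f' c \<ge> 0"
      using nonneg[of c] \<open>c \<in> {s..t}\<close> that by simp
    ultimately show ?thesis by simp
  qed
  have "(f \<longlongrightarrow> Sup (f ` {0..})) at_top"
  proof (rule increasing_tendsto)
    show "eventually (\<lambda>t. f t \<le> Sup (f ` {0..})) at_top"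
      using eventually_ge_at_top[of 0] by eventually_elim (auto intro: cSup_upper bdd)
    fix x assume "x < Sup (f ` {0..})"
    then obtain s where s: "s \<ge> 0" "x < f s"
      using less_cSup_iff[OF _ bdd] by auto
    show "eventually (\<lambda>t. x < f t) at_top"
      using eventually_ge_at_top[of s] by eventually_elim (use s mono in force)
  qed
  with deriv uc show ?thesis by (rule barbalat)
qed

text \<open>The part of \<open>K\<close> where \<open>norm (\<psi> p) \<ge> e\<close> is compact and
  contains no zero of \<open>\<phi>\<close>, so \<open>norm (\<phi> p)\<close> has a positive
  minimum there. Once \<open>norm (\<phi> (u t))\<close> is below it, \<open>u t\<close> lies
  outside that part.\<close>

lemma compact_tendsto_zero_transfer:
  fixes \<phi> :: "'a::metric_space \<Rightarrow> 'b::real_normed_vector"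
    and \<psi> :: "'a \<Rightarrow> 'c::real_normed_vector"
  assumes K: "compact K" and \<phi>: "continuous_on K \<phi>" and \<psi>: "continuous_on K \<psi>"
    and zero: "\<And>p. p \<in> K \<Longrightarrow> \<phi> p = 0 \<Longrightarrow> \<psi> p = 0"
    and in_K: "eventually (\<lambda>t. u t \<in> K) T"
    and lim: "((\<lambda>t. \<phi> (u t)) \<longlongrightarrow> 0) T"
  shows "((\<lambda>t. \<psi> (u t)) \<longlongrightarrow> 0) T"
proof (rule tendstoI)
  fix e :: real assume e: "e > 0"
  let ?S = "K \<inter> (\<lambda>p. norm (\<psi> p)) -` {e..}"
  have "compact ?S"
    using compact_Int_closed[OF K continuous_closed_preimage[OF continuous_on_norm[OF \<psi>]
          compact_imp_closed[OF K] closed_atLeast[of e]]]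
    by (simp add: Int_assoc[symmetric])
  show "eventually (\<lambda>t. dist (\<psi> (u t)) 0 < e) T"
  proof (cases "?S = {}")
    case True
    from in_K show ?thesis by eventually_elim (use True in force)
  next
    case False
    have "continuous_on ?S (\<lambda>p. norm (\<phi> p))"
      by (intro continuous_on_norm continuous_on_subset[OF \<phi>]) auto
    from continuous_attains_inf[OF \<open>compact ?S\<close> False this]
    obtain q where q: "q \<in> ?S" "\<And>p. p \<in> ?S \<Longrightarrow> norm (\<phi> q) \<le> norm (\<phi> p)"
      by (elim bexE) simp
    then have "norm (\<phi> q) > 0"
      using zero[of q] e by auto
    with lim have "eventually (\<lambda>t. dist (\<phi> (u t)) 0 < norm (\<phi> q)) T"
      by (rule tendstoD)
    with in_K show ?thesis
      by eventually_elim (use q(2) in force)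
  qed
qed

lemma linear_blinfun_apply: "linear (blinfun_apply f)"
  by (simp add: bounded_linear.linear blinfun.bounded_linear_right)

text \<open>\<open>F\<close> is linear in \<open>x\<close>, and the adjoint moves the derivative of
  \<open>g\<close> across the inner product. The result replaces the \<open>THE\<close> in
  \<open>gradient\<close> by an explicit field.\<close>

lemma saddle_point_field_inner:
  fixes g :: "'b::euclidean_space \<Rightarrow> 'a::euclidean_space"
  assumes F_form: "\<And>x z. F (x, z) = g z \<bullet> x"
    and deriv: "\<And>z. (g has_derivative blinfun_apply (g' z)) (at z)"
  shows "saddle_point_field F (x, z) = (- g z, adjoint (g' z) x)"
proof -
  have "gradient (\<lambda>x'. F (x', z)) x = g z"
    by (rule gradient_eqI) (auto simp: gderiv_def F_form inner_commute intro!: derivative_eq_intros)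
  moreover have "gradient (\<lambda>z'. F (x, z')) z = adjoint (g' z) x"
  proof (rule gradient_eqI)
    have "g' z h \<bullet> x = h \<bullet> adjoint (g' z) x" for h
      by (simp add: adjoint_works linear_blinfun_apply inner_commute)
    then show "GDERIV (\<lambda>z'. F (x, z')) z :> adjoint (g' z) x"
      unfolding gderiv_def F_form
      using has_derivative_inner_left[OF deriv[of z], of x] by simp
  qed
  ultimately show ?thesis by (simp add: saddle_point_field_def)
qed

text \<open>Since \<open>adjoint\<close> is defined by choice, these coordinates are what makes its
  joint continuity in \<open>f\<close> and \<open>x\<close> accessible.\<close>

lemma adjoint_eq_sum_Basis:
  fixes f :: "'b::euclidean_space \<Rightarrow> 'a::euclidean_space"
  assumes "linear f"
  shows "adjoint f x = (\<Sum>b\<in>Basis. (f b \<bullet> x) *\<^sub>R b)"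
proof -
  have "adjoint f x = (\<Sum>b\<in>Basis. (adjoint f x \<bullet> b) *\<^sub>R b)"
    by (simp add: euclidean_representation)
  also have "\<dots> = (\<Sum>b\<in>Basis. (f b \<bullet> x) *\<^sub>R b)"
    using adjoint_works[OF assms] by (simp add: inner_commute)
  finally show ?thesis .
qed

text \<open>The velocity is bounded because \<open>X\<close> is bounded on the compact set
  \<open>K\<close>; hence the trajectory is Lipschitz.\<close>

lemma uniformly_continuous_on_trajectory:
  assumes traj: "trajectory X \<gamma>" and K: "compact K" "\<And>t. t \<ge> 0 \<Longrightarrow> \<gamma> t \<in> K"
    and X: "continuous_on K X"
  shows "uniformly_continuous_on {0..} \<gamma>"
proof -
  have "bounded (X ` K)"
    using compact_continuous_image[OF X K(1)] by (rule compact_imp_bounded)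
  then obtain B where B: "B > 0" "\<And>p. p \<in> K \<Longrightarrow> norm (X p) \<le> B"
    by (auto simp: bounded_pos)
  have "B-lipschitz_on {0..} \<gamma>"
  proof (rule bounded_derivative_imp_lipschitz)
    fix t :: real assume t: "t \<in> {0..}"
    then show "(\<gamma> has_derivative (\<lambda>h. h *\<^sub>R X (\<gamma> t))) (at t within {0..})"
      using traj by (simp add: trajectory_def has_vector_derivative_def)
    show "onorm (\<lambda>h. h *\<^sub>R X (\<gamma> t)) \<le> B"
      using B K(2)[of t] t by (intro onorm_bound) (auto simp: mult.commute[of B] intro!: mult_left_mono)
  qed (use B in auto)
  then show ?thesis by (rule lipschitz_on_uniformly_continuous)
qed

lemma uniformly_continuous_on_compact_compose:
  fixes f :: "'b::metric_space \<Rightarrow> 'c::metric_space"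
  assumes "uniformly_continuous_on S u" "compact K" "u ` S \<subseteq> K" "continuous_on K f"
  shows "uniformly_continuous_on S (\<lambda>t. f (u t))"
proof (rule uniformly_continuous_on_compose[OF assms(1)])
  show "uniformly_continuous_on (u ` S) f"
    using compact_uniformly_continuous[OF assms(4) assms(2)] assms(3)
    unfolding uniformly_continuous_on_def by (meson subsetD)
qed

text \<open>The distance to the zero set is continuous and vanishes wherever \<open>X\<close> does,
  so it inherits the limit of \<open>X (\<gamma> t)\<close>.\<close>

lemma converges_to_equilibria:
  fixes X :: "'a::real_normed_vector \<Rightarrow> 'b::real_normed_vector"
  assumes X: "continuous_on UNIV X" and ne: "{p. X p = 0} \<noteq> {}"
    and K: "compact K" "\<And>t. t \<ge> 0 \<Longrightarrow> \<gamma> t \<in> K"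
    and lim: "((\<lambda>t. X (\<gamma> t)) \<longlongrightarrow> 0) at_top"
  shows "converges_to_set \<gamma> {p. X p = 0}"
proof -
  have "((\<lambda>t. infdist (\<gamma> t) {p. X p = 0}) \<longlongrightarrow> 0) at_top"
  proof (rule compact_tendsto_zero_transfer[OF K(1) _ _ _ _ lim])
    show "eventually (\<lambda>t. \<gamma> t \<in> K) at_top"
      using eventually_ge_at_top[of 0] by eventually_elim (rule K(2))
  qed (auto intro!: continuous_intros continuous_on_subset[OF X])
  with ne show ?thesis by (simp add: converges_to_set_def)
qed

theorem proposition5p7:
  fixes F :: "(real ^ 'n) \<times> (real ^ 'm) \<Rightarrow> real"
    and g :: "real ^ 'm \<Rightarrow> real ^ 'n"
  assumes F_form: "\<And>x z. F (x, z) = g z \<bullet> x"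
    and g_C1: "C1_map g"
    and hyp: "\<exists>xs zs. (xs, zs) \<in> Saddle F \<and>
      (\<forall>z. F (xs, zs) \<ge> F (xs, z)) \<and>
      (\<forall>z. g z \<bullet> xs = 0 \<longrightarrow> g z = 0) \<and>
      (\<forall>\<gamma>. trajectory (saddle_point_field F) \<gamma> \<longrightarrow> bounded (\<gamma> ` {0..}))"
  shows "\<forall>\<gamma>. trajectory (saddle_point_field F) \<gamma> \<longrightarrow>
      converges_to_set \<gamma> (equilibria (saddle_point_field F))"
proof (intro allI impI)
  fix \<gamma> assume traj: "trajectory (saddle_point_field F) \<gamma>"
  let ?X = "saddle_point_field F"
  obtain xs zs where saddle: "(xs, zs) \<in> Saddle F"
    and max: "\<And>z. F (xs, z) \<le> F (xs, zs)"
    and g_zero: "\<And>z. g z \<bullet> xs = 0 \<Longrightarrow> g z = 0"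
    and bdd: "bounded (\<gamma> ` {0..})"
    using hyp traj by blast
  obtain g' where g': "\<And>z. (g has_derivative blinfun_apply (g' z)) (at z)"
    and g'_cont: "continuous_on UNIV g'"
    using g_C1 unfolding C1_map_def by blast
  have g_cont: "continuous_on UNIV g"
    using g' by (intro has_derivative_continuous_on) (auto intro: has_derivative_at_withinI)
  have X_eq: "?X (x, z) = (- g z, adjoint (g' z) x)" for x z
    using F_form g' by (rule saddle_point_field_inner)
  have adj_cont: "continuous_on UNIV (\<lambda>p :: (real^'n) \<times> (real^'m). adjoint (g' (snd p)) (fst p))"
    unfolding adjoint_eq_sum_Basis[OF linear_blinfun_apply]
    by (intro continuous_intros continuous_on_compose2[OF g'_cont]) auto
  have gsnd_cont: "continuous_on UNIV (\<lambda>p :: (real^'n) \<times> (real^'m). g (snd p))"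
    by (intro continuous_intros continuous_on_compose2[OF g_cont]) auto
  have X_eq': "?X = (\<lambda>p. (- g (snd p), adjoint (g' (snd p)) (fst p)))"
    using X_eq by (simp add: fun_eq_iff)
  have X_cont: "continuous_on UNIV ?X"
    unfolding X_eq' by (intro continuous_intros adj_cont gsnd_cont)

  have "g zs = 0"
  proof -
    obtain U where U: "open U" "xs \<in> U" and min: "\<And>x. x \<in> U \<Longrightarrow> g zs \<bullet> xs \<le> g zs \<bullet> x"
      using saddle by (auto simp: Saddle_def F_form)
    obtain e where e: "e > 0" "cball xs e \<subseteq> U"
      using open_contains_cball U by blast
    \<comment> \<open>A descent step for the linear map. The \<open>+ 1\<close> keeps the step
      within radius \<open>e\<close> and avoids dividing by zero when
      \<open>g zs = 0\<close>.\<close>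
    define x where "x = xs - (e / (norm (g zs) + 1)) *\<^sub>R g zs"
    have "e * (norm (g zs) / (norm (g zs) + 1)) \<le> e * 1"
      using e by (intro mult_left_mono) (auto simp: add_nonneg_pos)
    then have "x \<in> cball xs e"
      using e by (simp add: x_def dist_norm)
    with e min have "g zs \<bullet> xs \<le> g zs \<bullet> x" by blast
    then have "(e / (norm (g zs) + 1)) * (g zs \<bullet> g zs) \<le> 0"
      by (simp add: x_def inner_diff_right)
    moreover have "e / (norm (g zs) + 1) > 0"
      using e by (simp add: add_nonneg_pos)
    ultimately show ?thesis
      by (metis inner_gt_zero_iff mult_pos_pos not_less)
  qed
  with max have g_nonpos: "g z \<bullet> xs \<le> 0" for z
    by (metis F_form inner_zero_left)

  define K where "K = closure (\<gamma> ` {0..})"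
  have K: "compact K" using bdd by (simp add: K_def compact_closure)
  have in_K: "\<gamma> t \<in> K" if "t \<ge> 0" for t
    using that closure_subset by (fastforce simp: K_def)
  then have ev_K: "eventually (\<lambda>t. \<gamma> t \<in> K) at_top"
    using eventually_at_top_linorder by blast
  \<comment> \<open>This provides the uniform continuity for both uses of Barbalat's lemma, as both
    derivatives are continuous functions of the state.\<close>
  have uc: "uniformly_continuous_on {0..} (\<lambda>t. \<phi> (\<gamma> t))" if "continuous_on UNIV \<phi>"
    for \<phi> :: "_ \<Rightarrow> real"
    using traj K in_K continuous_on_subset[OF X_cont] continuous_on_subset[OF that]
    by (intro uniformly_continuous_on_compact_compose[OF uniformly_continuous_on_trajectory]) auto
  define x z where "x t = fst (\<gamma> t)" and "z t = snd (\<gamma> t)" for t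
  have deriv: "(\<gamma> has_vector_derivative (- g (z t), adjoint (g' (z t)) (x t))) (at t within {0..})"
    if "t \<ge> 0" for t
    using traj that by (simp add: trajectory_def X_eq' x_def z_def)
  have x': "(x has_derivative (\<lambda>h. - h *\<^sub>R g (z t))) (at t within {0..})"
    and z': "(z has_derivative (\<lambda>h. h *\<^sub>R adjoint (g' (z t)) (x t))) (at t within {0..})"
    if "t \<ge> 0" for t
    using has_derivative_fst[OF deriv[OF that, unfolded has_vector_derivative_def]]
      has_derivative_snd[OF deriv[OF that, unfolded has_vector_derivative_def]]
    by (simp_all add: x_def[abs_def] z_def[abs_def])

  have "((\<lambda>t. - (g (z t) \<bullet> xs)) \<longlongrightarrow> 0) at_top"
  proof (rule barbalat_nondecreasing)
    show "((\<lambda>t. x t \<bullet> xs) has_vector_derivative - (g (z t) \<bullet> xs)) (at t within {0..})"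
      if "t \<ge> 0" for t
      using has_derivative_inner_left[OF x'[OF that], of xs] by (simp add: has_vector_derivative_def)
    show "uniformly_continuous_on {0..} (\<lambda>t. - (g (z t) \<bullet> xs))"
      unfolding z_def by (rule uc) (intro continuous_intros gsnd_cont)
    have "bounded ((\<lambda>p. fst p \<bullet> xs) ` K)"
      by (intro compact_imp_bounded compact_continuous_image K continuous_intros)
    then have "bounded ((\<lambda>t. x t \<bullet> xs) ` {0..})"
      by (rule bounded_subset) (use in_K in \<open>auto simp: x_def\<close>)
    then show "bdd_above ((\<lambda>t. x t \<bullet> xs) ` {0..})"
      by (rule bounded_imp_bdd_above)
  qed (use g_nonpos in simp)
  \<comment> \<open>Condition (ii) is exactly the inclusion of zero sets needed for the
    transfer.\<close>
  then have g_lim: "((\<lambda>t. g (z t)) \<longlongrightarrow> 0) at_top"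
    unfolding z_def
    by (rule compact_tendsto_zero_transfer[OF K _ _ _ ev_K, rotated -1])
      (auto intro!: continuous_intros continuous_on_subset[OF gsnd_cont] g_zero)
  have F_lim: "((\<lambda>t. g (z t) \<bullet> x t) \<longlongrightarrow> 0) at_top"
    using g_lim unfolding z_def x_def
    by (rule compact_tendsto_zero_transfer[OF K _ _ _ ev_K, rotated -1])
      (auto intro!: continuous_intros continuous_on_subset[OF gsnd_cont])

  let ?h = "\<lambda>t. (norm (adjoint (g' (z t)) (x t)))\<^sup>2 - (norm (g (z t)))\<^sup>2"
  have "(?h \<longlongrightarrow> 0) at_top"
  \<comment> \<open>The sign of \<open>?h\<close> is not controlled, so the limit of
    \<open>F\<close> has to come from \<open>F_lim\<close> instead of monotonicity.\<close>
  proof (rule barbalat[OF _ _ F_lim])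
    fix t :: real assume t: "t \<ge> 0"
    have "((\<lambda>t. g (z t)) has_derivative (\<lambda>h. g' (z t) (h *\<^sub>R adjoint (g' (z t)) (x t)))) (at t within {0..})"
      using has_derivative_compose[OF z'[OF t] g'] .
    \<comment> \<open>With \<open>v = adjoint (g' (z t)) (x t)\<close>, the adjoint identity turns
      \<open>g' (z t) v \<bullet> x t\<close> into \<open>v \<bullet> v\<close>; the other summand
      is \<open>g (z t) \<bullet> (- g (z t))\<close>.\<close>
    from has_derivative_inner[OF this x'[OF t]]
    show "((\<lambda>t. g (z t) \<bullet> x t) has_vector_derivative ?h t) (at t within {0..})"
      unfolding has_vector_derivative_def
      by (rule has_derivative_eq_rhs)
        (auto simp: fun_eq_iff blinfun.scaleR_right adjoint_works[OF linear_blinfun_apply]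
          inner_commute[of "blinfun_apply _ _"] power2_norm_eq_inner algebra_simps)
  qed (unfold z_def x_def, rule uc, intro continuous_intros gsnd_cont adj_cont)
  from tendsto_add[OF this tendsto_power[OF tendsto_norm[OF g_lim], of 2]]
  have "((\<lambda>t. (norm (adjoint (g' (z t)) (x t)))\<^sup>2) \<longlongrightarrow> 0) at_top"
    by simp
  then have "((\<lambda>t. adjoint (g' (z t)) (x t)) \<longlongrightarrow> 0) at_top"
    by (auto dest: tendsto_real_sqrt intro: tendsto_norm_zero_cancel)
  with g_lim have "((\<lambda>t. ?X (\<gamma> t)) \<longlongrightarrow> 0) at_top"
    unfolding X_eq' z_def x_def zero_prod_def by (auto intro!: tendsto_eq_intros)
  \<comment> \<open>An equilibrium witnesses the nonemptiness demanded by
    \<open>converges_to_set\<close>: \<open>g zs = 0\<close> kills the first component,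
    \<open>x = 0\<close> the second.\<close>
  moreover have "?X (0, zs) = 0"
    by (simp add: X_eq \<open>g zs = 0\<close> adjoint_eq_sum_Basis linear_blinfun_apply zero_prod_def)
  ultimately show "converges_to_set \<gamma> (equilibria ?X)"
    unfolding equilibria_def
    by (intro converges_to_equilibria[OF X_cont _ K in_K]) auto
qed

end
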